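(* Let $\mathcal{K}=\mathcal{K}_1\times\mathcal{K}_2$, let $\pi=(\pi_1,\pi_2)\in\mathbb{Z}^{n_1}\times\mathbb{Z}^{n_2}$ and $\pi_0\in\mathbb{Z}$. Let $(\alpha,\beta,u,\lambda,v)$ be feasible for the cut-generating conic problem of the split disjunction $(\pi^Tx\le\pi_0)\vee(\pi^Tx\ge\pi_0+1)$, namely $$\min\ \alpha^T\bar x-\beta\quad\text{s.t.}\quad \alpha=A^Tu_1+\lambda_1-v_1\pi,\quad \alpha=A^Tu_2+\lambda_2+v_2\pi,\quad \beta\le b^Tu_1-v_1\pi_0,\quad \beta\le b^Tu_2+v_2(\pi_0+1),\quad \lambda_1,\lambda_2\in\mathcal{K}^*,\quad v_1,v_2\ge 0,$$ with $u_1,u_2\in\mathbb{R}^m$ and $v_1,v_2\in\mathbb{R}$, and write $\alpha=(\alpha_1,\alpha_2)\in\mathbb{R}^{n_1}\times\mathbb{R}^{n_2}$. Let $\tilde\alpha_2\in\mathbb{R}^{n_2}$ and $\delta\pi\in\mathbb{Z}^{n_2}$ be such that $$\tilde\alpha_2-\left(A_2^Tu_1-v_1(\pi_2+\delta\pi)\right)\in\mathcal{K}_2^*,\qquad \tilde\alpha_2-\left(A_2^Tu_2+v_2(\pi_2+\delta\pi)\right)\in\mathcal{K}_2^*.$$ Then, with $\tilde\alpha=(\alpha_1,\tilde\alpha_2)$ and $\tilde\pi=(\pi_1,\pi_2+\delta\pi)$, the inequality $\tilde\alpha^Tx\ge\beta$ is valid for (i.e. satisfied by every element of) the disjunctive set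 $$\tilde{\mathcal{D}}=\{x : Ax=b,\ x\in\mathcal{K},\ \tilde\pi^Tx\le\pi_0\}\cup\{x : Ax=b,\ x\in\mathcal{K},\ \tilde\pi^Tx\ge\pi_0+1\}.$$
   Context: Setting (pure integer case, $x\in\mathbb{Z}^n$): $A=[A_1\ A_2]\in\mathbb{R}^{m\times n}$ with $A_i\in\mathbb{R}^{m\times n_i}$, $n=n_1+n_2$; $b\in\mathbb{R}^m$; $\mathcal{K}_i\subseteq\mathbb{R}^{n_i}$ ($i=1,2$) are proper cones (closed, convex, pointed, with non-empty interior) and $\mathcal{K}=\mathcal{K}_1\times\mathcal{K}_2$. The point $\bar x=(\bar x_1,\bar x_2)\in\mathbb{R}^n$ satisfies $A\bar x=b$ and $\bar x_2=0$. For a cone $\mathcal{C}$, the dual cone is $\mathcal{C}^*=\{u : u^Tx\ge 0\ \forall x\in\mathcal{C}\}$. *)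

theory Defs
  imports "HOL-Analysis.Analysis"
begin

text \<open>
  The space of dimension \<open>n = n\<^sub>1 + n\<^sub>2\<close> is rendered as the Euclidean product
  \<open>(real^'n1) \<times> (real^'n2)\<close>, so that a vector \<open>x = (x\<^sub>1, x\<^sub>2)\<close> is a pair, the inner product
  of pairs is the sum of the blockwise inner products, and \<open>K\<^sub>1 \<times> K\<^sub>2\<close> is the ordinary
  product of sets. Accordingly a matrix \<open>A = [A\<^sub>1 A\<^sub>2]\<close> is given by its two column blocks.
\<close>

definition block_mult ::
  "real^'n1^'m \<Rightarrow> real^'n2^'m \<Rightarrow> (real^'n1) \<times> (real^'n2) \<Rightarrow> real^'m"
  where "block_mult A1 A2 x = A1 *v fst x + A2 *v snd x"

definition block_transpose_mult ::
  "real^'n1^'m \<Rightarrow> real^'n2^'m \<Rightarrow> real^'m \<Rightarrow> (real^'n1) \<times> (real^'n2)"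
  where "block_transpose_mult A1 A2 u = (transpose A1 *v u, transpose A2 *v u)"

lemma inner_block_transpose_mult:
  "block_transpose_mult A1 A2 u \<bullet> x = u \<bullet> block_mult A1 A2 x"
  by (simp add: block_transpose_mult_def block_mult_def inner_prod_def inner_add_right
      dot_lmul_matrix)

definition real_vec :: "int^'n \<Rightarrow> real^'n"
  where "real_vec p = (\<chi> i. real_of_int (p $ i))"

definition real_pair :: "(int^'n1) \<times> (int^'n2) \<Rightarrow> (real^'n1) \<times> (real^'n2)"
  where "real_pair p = (real_vec (fst p), real_vec (snd p))"

text \<open>The library predicate \<^const>\<open>cone\<close> means closure under nonnegative scaling.\<close>

definition proper_cone :: "'a::euclidean_space set \<Rightarrow> bool"
  where "proper_cone C \<longleftrightarrow>
    cone C \<and> closed C \<and> convex C \<and> C \<inter> uminus ` C = {0} \<and> interior C \<noteq> {}"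

definition dual_cone :: "'a::real_inner set \<Rightarrow> 'a set"
  where "dual_cone C = {u. \<forall>x\<in>C. u \<bullet> x \<ge> 0}"

text \<open>Feasibility for the cut-generating conic problem of the split disjunction
  \<open>\<pi>\<^sup>T x \<le> \<pi>\<^sub>0 \<or> \<pi>\<^sup>T x \<ge> \<pi>\<^sub>0 + 1\<close>; the objective \<open>\<alpha>\<^sup>T x - \<beta>\<close>, taken at the point to be separated,
  plays no role for feasibility.\<close>

definition cgcp_feasible ::
  "real^'n1^'m \<Rightarrow> real^'n2^'m \<Rightarrow> real^'m \<Rightarrow> ((real^'n1) \<times> (real^'n2)) set \<Rightarrow>
   (int^'n1) \<times> (int^'n2) \<Rightarrow> int \<Rightarrow>
   (real^'n1) \<times> (real^'n2) \<Rightarrow> real \<Rightarrow> real^'m \<Rightarrow> real^'m \<Rightarrow>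
   (real^'n1) \<times> (real^'n2) \<Rightarrow> (real^'n1) \<times> (real^'n2) \<Rightarrow> real \<Rightarrow> real \<Rightarrow> bool"
  where "cgcp_feasible A1 A2 b K \<pi> \<pi>0 \<alpha> \<beta> u1 u2 l1 l2 v1 v2 \<longleftrightarrow>
    \<alpha> = block_transpose_mult A1 A2 u1 + l1 - v1 *\<^sub>R real_pair \<pi> \<and>
    \<alpha> = block_transpose_mult A1 A2 u2 + l2 + v2 *\<^sub>R real_pair \<pi> \<and>
    \<beta> \<le> b \<bullet> u1 - v1 * real_of_int \<pi>0 \<and>
    \<beta> \<le> b \<bullet> u2 + v2 * (real_of_int \<pi>0 + 1) \<and>
    l1 \<in> dual_cone K \<and> l2 \<in> dual_cone K \<and> v1 \<ge> 0 \<and> v2 \<ge> 0"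

definition disjunctive_set ::
  "real^'n1^'m \<Rightarrow> real^'n2^'m \<Rightarrow> real^'m \<Rightarrow> ((real^'n1) \<times> (real^'n2)) set \<Rightarrow>
   (int^'n1) \<times> (int^'n2) \<Rightarrow> int \<Rightarrow> ((real^'n1) \<times> (real^'n2)) set"
  where "disjunctive_set A1 A2 b K \<pi> \<pi>0 =
    {x. block_mult A1 A2 x = b \<and> x \<in> K \<and> real_pair \<pi> \<bullet> x \<le> real_of_int \<pi>0} \<union>
    {x. block_mult A1 A2 x = b \<and> x \<in> K \<and> real_pair \<pi> \<bullet> x \<ge> real_of_int \<pi>0 + 1}"

definition valid_inequality :: "'a::real_inner \<Rightarrow> real \<Rightarrow> 'a set \<Rightarrow> bool"
  where "valid_inequality \<alpha> \<beta> S \<longleftrightarrow> (\<forall>x\<in>S. \<alpha> \<bullet> x \<ge> \<beta>)"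

end

theory Submission
  imports Defs
begin

text \<open>Replacing the second block of the multipliers \<open>l1\<close>, \<open>l2\<close> by the given residuals yields a
  feasible solution of the cut-generating problem for the disjunction along \<open>(\<pi>1, \<pi>2 + \<delta>\<pi>)\<close>, and
  feasible solutions certify valid inequalities.\<close>

text \<open>Testing against \<open>(x, 0)\<close> and \<open>(0, y)\<close> isolates the two blocks
  of a functional, which is why both factors must contain \<open>0\<close>; conversely, the inner
  product of pairs is a sum of two nonnegative terms. This splitting allows one block of a
  multiplier to be changed while the other is kept.\<close>

lemma dual_cone_Times:
  assumes "0 \<in> K1" "0 \<in> K2"
  shows "dual_cone (K1 \<times> K2) = dual_cone K1 \<times> dual_cone K2"
proof (intro set_eqI iffI)
  fix l assume "l \<in> dual_cone (K1 \<times> K2)"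
  then have l: "l \<bullet> (x, y) \<ge> 0" if "x \<in> K1" "y \<in> K2" for x y
    using that by (auto simp: dual_cone_def)
  show "l \<in> dual_cone K1 \<times> dual_cone K2"
    using l[OF _ assms(2)] l[OF assms(1)]
    by (auto simp: dual_cone_def inner_prod_def mem_Times_iff)
qed (auto simp: dual_cone_def)

text \<open>Pointedness is stated as an equation with \<open>{0}\<close>, so it already puts
  \<open>0\<close> in the cone.\<close>

lemma proper_cone_contains_0: "proper_cone C \<Longrightarrow> 0 \<in> C"
  by (auto simp: proper_cone_def)

text \<open>Weak duality on each side of the split: the equations are aggregated with
  \<open>u1\<close> or \<open>u2\<close>, membership in \<open>K\<close> with \<open>l1\<close> or
  \<open>l2\<close>, and the split inequality with \<open>v1\<close> or \<open>v2\<close>.\<close>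

lemma cgcp_feasible_imp_valid_inequality:
  assumes "cgcp_feasible A1 A2 b K \<pi> \<pi>0 \<alpha> \<beta> u1 u2 l1 l2 v1 v2"
  shows "valid_inequality \<alpha> \<beta> (disjunctive_set A1 A2 b K \<pi> \<pi>0)"
  unfolding valid_inequality_def
proof
  fix x assume "x \<in> disjunctive_set A1 A2 b K \<pi> \<pi>0"
  then consider
      (left) "block_mult A1 A2 x = b" "x \<in> K" "real_pair \<pi> \<bullet> x \<le> real_of_int \<pi>0"
    | (right) "block_mult A1 A2 x = b" "x \<in> K" "real_pair \<pi> \<bullet> x \<ge> real_of_int \<pi>0 + 1"
    by (auto simp: disjunctive_set_def)
  then show "\<alpha> \<bullet> x \<ge> \<beta>"
  proof cases
    case left
    have "\<alpha> \<bullet> x = (block_transpose_mult A1 A2 u1 + l1 - v1 *\<^sub>R real_pair \<pi>) \<bullet> x"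
      using assms by (metis cgcp_feasible_def)
    also have "\<dots> = b \<bullet> u1 + l1 \<bullet> x - v1 * (real_pair \<pi> \<bullet> x)"
      by (simp add: inner_add_left inner_diff_left inner_block_transpose_mult left(1) inner_commute[of b])
    moreover have "l1 \<bullet> x \<ge> 0"
      using assms left(2) by (simp add: cgcp_feasible_def dual_cone_def)
    \<comment> \<open>The term with \<open>v1\<close> enters \<alpha> with a minus sign, so the
      upper bound on this side of the split becomes a lower bound on
      \<open>\<alpha> \<bullet> x\<close>.\<close>
    moreover have "v1 * (real_pair \<pi> \<bullet> x) \<le> v1 * real_of_int \<pi>0"
      using assms left(3) by (intro mult_left_mono) (simp_all add: cgcp_feasible_def)
    moreover have "\<beta> \<le> b \<bullet> u1 - v1 * real_of_int \<pi>0"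
      using assms by (simp add: cgcp_feasible_def)
    ultimately show ?thesis by linarith
  next
    case right
    have "\<alpha> \<bullet> x = (block_transpose_mult A1 A2 u2 + l2 + v2 *\<^sub>R real_pair \<pi>) \<bullet> x"
      using assms by (metis cgcp_feasible_def)
    also have "\<dots> = b \<bullet> u2 + l2 \<bullet> x + v2 * (real_pair \<pi> \<bullet> x)"
      by (simp add: inner_add_left inner_block_transpose_mult right(1) inner_commute[of b])
    moreover have "l2 \<bullet> x \<ge> 0"
      using assms right(2) by (simp add: cgcp_feasible_def dual_cone_def)
    moreover have "v2 * (real_of_int \<pi>0 + 1) \<le> v2 * (real_pair \<pi> \<bullet> x)"
      using assms right(3) by (intro mult_left_mono) (simp_all add: cgcp_feasible_def)
    moreover have "\<beta> \<le> b \<bullet> u2 + v2 * (real_of_int \<pi>0 + 1)"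
      using assms by (simp add: cgcp_feasible_def)
    ultimately show ?thesis by linarith
  qed
qed

theorem lemma5:
  fixes A1 :: "real^'n1^'m" and A2 :: "real^'n2^'m" and b :: "real^'m"
    and K1 :: "(real^'n1) set" and K2 :: "(real^'n2) set"
    and xbar :: "(real^'n1) \<times> (real^'n2)"
    and \<pi>1 :: "int^'n1" and \<pi>2 \<delta>\<pi> :: "int^'n2" and \<pi>0 :: int
    and \<alpha>1 :: "real^'n1" and \<alpha>2 \<alpha>2' :: "real^'n2" and \<beta> :: real
    and u1 u2 :: "real^'m" and l1 l2 :: "(real^'n1) \<times> (real^'n2)" and v1 v2 :: real
  assumes "proper_cone K1" and "proper_cone K2"
    and "block_mult A1 A2 xbar = b" and "snd xbar = 0"
    and "cgcp_feasible A1 A2 b (K1 \<times> K2) (\<pi>1, \<pi>2) \<pi>0 (\<alpha>1, \<alpha>2) \<beta> u1 u2 l1 l2 v1 v2"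
    and "\<alpha>2' - (transpose A2 *v u1 - v1 *\<^sub>R real_vec (\<pi>2 + \<delta>\<pi>)) \<in> dual_cone K2"
    and "\<alpha>2' - (transpose A2 *v u2 + v2 *\<^sub>R real_vec (\<pi>2 + \<delta>\<pi>)) \<in> dual_cone K2"
  shows "valid_inequality (\<alpha>1, \<alpha>2') \<beta>
    (disjunctive_set A1 A2 b (K1 \<times> K2) (\<pi>1, \<pi>2 + \<delta>\<pi>) \<pi>0)"
proof -
  \<comment> \<open>These residuals come from solving the second block of the two equations for the
    multipliers, with the modified data \<open>\<alpha>2'\<close> and
    \<open>\<pi>2 + \<delta>\<pi>\<close>.\<close>
  let ?r1 = "\<alpha>2' - (transpose A2 *v u1 - v1 *\<^sub>R real_vec (\<pi>2 + \<delta>\<pi>))"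
  let ?r2 = "\<alpha>2' - (transpose A2 *v u2 + v2 *\<^sub>R real_vec (\<pi>2 + \<delta>\<pi>))"
  have dual: "dual_cone (K1 \<times> K2) = dual_cone K1 \<times> dual_cone K2"
    using assms(1,2) by (intro dual_cone_Times proper_cone_contains_0)
  have feas: "(\<alpha>1, \<alpha>2) = block_transpose_mult A1 A2 u1 + l1 - v1 *\<^sub>R real_pair (\<pi>1, \<pi>2)"
      "(\<alpha>1, \<alpha>2) = block_transpose_mult A1 A2 u2 + l2 + v2 *\<^sub>R real_pair (\<pi>1, \<pi>2)"
      "\<beta> \<le> b \<bullet> u1 - v1 * real_of_int \<pi>0" "\<beta> \<le> b \<bullet> u2 + v2 * (real_of_int \<pi>0 + 1)"
      "l1 \<in> dual_cone (K1 \<times> K2)" "l2 \<in> dual_cone (K1 \<times> K2)" "v1 \<ge> 0" "v2 \<ge> 0"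
    using assms(5) unfolding cgcp_feasible_def by blast+
  \<comment> \<open>The modification leaves \<alpha>1 and \<pi>1 unchanged, so the first block of
    each original equation carries over with \<open>fst l1\<close> and
    \<open>fst l2\<close>.\<close>
  have fst1: "\<alpha>1 = transpose A1 *v u1 + fst l1 - v1 *\<^sub>R real_vec \<pi>1"
    using arg_cong[OF feas(1), of fst] by (simp add: block_transpose_mult_def real_pair_def)
  have fst2: "\<alpha>1 = transpose A1 *v u2 + fst l2 + v2 *\<^sub>R real_vec \<pi>1"
    using arg_cong[OF feas(2), of fst] by (simp add: block_transpose_mult_def real_pair_def)
  have "cgcp_feasible A1 A2 b (K1 \<times> K2) (\<pi>1, \<pi>2 + \<delta>\<pi>) \<pi>0 (\<alpha>1, \<alpha>2') \<beta> u1 u2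
      (fst l1, ?r1) (fst l2, ?r2) v1 v2"
    unfolding cgcp_feasible_def
  proof (intro conjI)
    show "(\<alpha>1, \<alpha>2') = block_transpose_mult A1 A2 u1 + (fst l1, ?r1)
        - v1 *\<^sub>R real_pair (\<pi>1, \<pi>2 + \<delta>\<pi>)"
      using fst1 by (simp add: prod_eq_iff block_transpose_mult_def real_pair_def)
    show "(\<alpha>1, \<alpha>2') = block_transpose_mult A1 A2 u2 + (fst l2, ?r2)
        + v2 *\<^sub>R real_pair (\<pi>1, \<pi>2 + \<delta>\<pi>)"
      using fst2 by (simp add: prod_eq_iff block_transpose_mult_def real_pair_def)
    \<comment> \<open>By the product form of the dual cone, the first blocks inherit membership from
      \<open>l1\<close> and \<open>l2\<close>, and the second blocks are exactly the two residual
      conditions assumed on \<open>\<alpha>2'\<close>.\<close>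
    show "(fst l1, ?r1) \<in> dual_cone (K1 \<times> K2)" "(fst l2, ?r2) \<in> dual_cone (K1 \<times> K2)"
      using feas(5,6) assms(6,7) by (simp_all add: dual mem_Times_iff)
  \<comment> \<open>The bounds on \<beta> and the signs of \<open>v1\<close> and \<open>v2\<close>
    involve neither the split normal nor the cut coefficients, so they transfer verbatim.\<close>
  qed (fact feas)+
  then show ?thesis
    by (rule cgcp_feasible_imp_valid_inequality)
qed

end
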